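(* Let $k$ be a field, let $B\subset A$ be an inclusion of $k$-algebras and let $X$ be an $A$-bimodule. Then the sequence $$0\to H^1(A|B,X)\xrightarrow{\ \iota\ } H^1(A,X)\xrightarrow{\ \kappa\ } H^1(B,X)$$ is exact.
   Context: Algebras are associative and unital, and inclusions preserve the unit. $H^n(A,X)$ denotes Hochschild cohomology of $A$ with coefficients in the bimodule $X$; $H^1(A,X)$ is the quotient of the space of $k$-derivations $A\to X$ by the inner derivations $a\mapsto xa-ax$, $x\in X$. The $A$-bimodule $X$ is regarded as a $B$-bimodule by restriction. The relative Hochschild cohomology is $H^n(A|B,X)=\mathrm{Ext}^n_{A\otimes A^{op}|B\otimes B^{op}}(A,X)$, the relative Ext of G. Hochschild for the inclusion $B\otimes B^{op}\subset A\otimes A^{op}$ (tensor products over $k$). In degree one, $H^1(A|B,X)$ is the quotient of the space of relative derivations (derivations $A\to X$ which are morphisms of $B$-bimodules) by the inner derivations $a\mapsto xa-ax$ with $x\in X^B=\{x\in X\mid bx=xb\ \text{for all } b\in B\}$. The map $\iota$ is induced by viewing a relative derivation as a derivation, and $\kappa$ is induced by restricting a derivation from $A$ to $B$. *)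

theory Defs
  imports "HOL-Algebra.Module" "HOL-Algebra.AbelCoset" "HOL-Algebra.Subrings"
begin

section \<open>Algebras and bimodules\<close>

text \<open>The locale \<^locale>\<open>algebra\<close> of the library requires commutative multiplication,
  hence this version. The zero algebra is allowed.\<close>

locale assoc_algebra = field K + module K A + ring A
  for K (structure) and A (structure) +
  assumes smult_mult_left:
      "\<lbrakk>c \<in> carrier K; a \<in> carrier A; b \<in> carrier A\<rbrakk> \<Longrightarrow>
        (c \<odot>\<^bsub>A\<^esub> a) \<otimes>\<^bsub>A\<^esub> b = c \<odot>\<^bsub>A\<^esub> (a \<otimes>\<^bsub>A\<^esub> b)"
    and smult_mult_right:
      "\<lbrakk>c \<in> carrier K; a \<in> carrier A; b \<in> carrier A\<rbrakk> \<Longrightarrow>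
        a \<otimes>\<^bsub>A\<^esub> (c \<odot>\<^bsub>A\<^esub> b) = c \<odot>\<^bsub>A\<^esub> (a \<otimes>\<^bsub>A\<^esub> b)"

locale unital_subalgebra = submodule B K A + submonoid B A
  for B and K and A (structure)

text \<open>As usual for \<^typ>\<open>('k, 'x) module\<close>, the inherited ring multiplication and unit of
  the record are junk; only the additive group, the scalars and the two actions matter.\<close>

record ('k, 'a, 'x) bimodule = "('k, 'x) module" +
  lact :: "'a \<Rightarrow> 'x \<Rightarrow> 'x"  (infixr \<open>\<triangleright>\<index>\<close> 70)
  ract :: "'x \<Rightarrow> 'a \<Rightarrow> 'x"  (infixl \<open>\<triangleleft>\<index>\<close> 70)

text \<open>The last four assumptions say that the two \<open>k\<close>-module structures on \<open>X\<close> coming from the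
  left and the right action of \<open>A\<close> both agree with the given one, i.e. \<open>X\<close> is a module over
  \<open>A \<otimes> A\<^sup>o\<^sup>p\<close>, the tensor product being taken over \<open>k\<close>.\<close>

locale bimodule = assoc_algebra K A + X?: module K X
  for K (structure) and A :: "('k, 'a, 'm) module_scheme" (structure)
    and X :: "('k, 'a, 'x, 'n) bimodule_scheme" (structure) +
  assumes lact_closed:
      "\<lbrakk>a \<in> carrier A; x \<in> carrier X\<rbrakk> \<Longrightarrow> a \<triangleright>\<^bsub>X\<^esub> x \<in> carrier X"
    and ract_closed:
      "\<lbrakk>a \<in> carrier A; x \<in> carrier X\<rbrakk> \<Longrightarrow> x \<triangleleft>\<^bsub>X\<^esub> a \<in> carrier X"
    and lact_add_left:
      "\<lbrakk>a \<in> carrier A; b \<in> carrier A; x \<in> carrier X\<rbrakk> \<Longrightarrow>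
        (a \<oplus>\<^bsub>A\<^esub> b) \<triangleright>\<^bsub>X\<^esub> x = (a \<triangleright>\<^bsub>X\<^esub> x) \<oplus>\<^bsub>X\<^esub> (b \<triangleright>\<^bsub>X\<^esub> x)"
    and lact_add_right:
      "\<lbrakk>a \<in> carrier A; x \<in> carrier X; y \<in> carrier X\<rbrakk> \<Longrightarrow>
        a \<triangleright>\<^bsub>X\<^esub> (x \<oplus>\<^bsub>X\<^esub> y) = (a \<triangleright>\<^bsub>X\<^esub> x) \<oplus>\<^bsub>X\<^esub> (a \<triangleright>\<^bsub>X\<^esub> y)"
    and ract_add_left:
      "\<lbrakk>a \<in> carrier A; x \<in> carrier X; y \<in> carrier X\<rbrakk> \<Longrightarrow>
        (x \<oplus>\<^bsub>X\<^esub> y) \<triangleleft>\<^bsub>X\<^esub> a = (x \<triangleleft>\<^bsub>X\<^esub> a) \<oplus>\<^bsub>X\<^esub> (y \<triangleleft>\<^bsub>X\<^esub> a)"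
    and ract_add_right:
      "\<lbrakk>a \<in> carrier A; b \<in> carrier A; x \<in> carrier X\<rbrakk> \<Longrightarrow>
        x \<triangleleft>\<^bsub>X\<^esub> (a \<oplus>\<^bsub>A\<^esub> b) = (x \<triangleleft>\<^bsub>X\<^esub> a) \<oplus>\<^bsub>X\<^esub> (x \<triangleleft>\<^bsub>X\<^esub> b)"
    and lact_assoc:
      "\<lbrakk>a \<in> carrier A; b \<in> carrier A; x \<in> carrier X\<rbrakk> \<Longrightarrow>
        (a \<otimes>\<^bsub>A\<^esub> b) \<triangleright>\<^bsub>X\<^esub> x = a \<triangleright>\<^bsub>X\<^esub> (b \<triangleright>\<^bsub>X\<^esub> x)"
    and ract_assoc:
      "\<lbrakk>a \<in> carrier A; b \<in> carrier A; x \<in> carrier X\<rbrakk> \<Longrightarrow>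
        x \<triangleleft>\<^bsub>X\<^esub> (a \<otimes>\<^bsub>A\<^esub> b) = (x \<triangleleft>\<^bsub>X\<^esub> a) \<triangleleft>\<^bsub>X\<^esub> b"
    and lact_ract_assoc:
      "\<lbrakk>a \<in> carrier A; b \<in> carrier A; x \<in> carrier X\<rbrakk> \<Longrightarrow>
        (a \<triangleright>\<^bsub>X\<^esub> x) \<triangleleft>\<^bsub>X\<^esub> b = a \<triangleright>\<^bsub>X\<^esub> (x \<triangleleft>\<^bsub>X\<^esub> b)"
    and lact_one: "x \<in> carrier X \<Longrightarrow> \<one>\<^bsub>A\<^esub> \<triangleright>\<^bsub>X\<^esub> x = x"
    and ract_one: "x \<in> carrier X \<Longrightarrow> x \<triangleleft>\<^bsub>X\<^esub> \<one>\<^bsub>A\<^esub> = x"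
    and lact_smult_left:
      "\<lbrakk>c \<in> carrier K; a \<in> carrier A; x \<in> carrier X\<rbrakk> \<Longrightarrow>
        (c \<odot>\<^bsub>A\<^esub> a) \<triangleright>\<^bsub>X\<^esub> x = c \<odot>\<^bsub>X\<^esub> (a \<triangleright>\<^bsub>X\<^esub> x)"
    and lact_smult_right:
      "\<lbrakk>c \<in> carrier K; a \<in> carrier A; x \<in> carrier X\<rbrakk> \<Longrightarrow>
        a \<triangleright>\<^bsub>X\<^esub> (c \<odot>\<^bsub>X\<^esub> x) = c \<odot>\<^bsub>X\<^esub> (a \<triangleright>\<^bsub>X\<^esub> x)"
    and ract_smult_left:
      "\<lbrakk>c \<in> carrier K; a \<in> carrier A; x \<in> carrier X\<rbrakk> \<Longrightarrow>
        (c \<odot>\<^bsub>X\<^esub> x) \<triangleleft>\<^bsub>X\<^esub> a = c \<odot>\<^bsub>X\<^esub> (x \<triangleleft>\<^bsub>X\<^esub> a)"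
    and ract_smult_right:
      "\<lbrakk>c \<in> carrier K; a \<in> carrier A; x \<in> carrier X\<rbrakk> \<Longrightarrow>
        x \<triangleleft>\<^bsub>X\<^esub> (c \<odot>\<^bsub>A\<^esub> a) = c \<odot>\<^bsub>X\<^esub> (x \<triangleleft>\<^bsub>X\<^esub> a)"


section \<open>Linear maps and quotient modules\<close>

definition module_hom ::
  "('k, 'r) ring_scheme \<Rightarrow> ('k, 'x, 'm) module_scheme \<Rightarrow> ('k, 'y, 'n) module_scheme \<Rightarrow> ('x \<Rightarrow> 'y) set"
  where "module_hom K M N = {f \<in> hom (add_monoid M) (add_monoid N).
    \<forall>c \<in> carrier K. \<forall>x \<in> carrier M. f (c \<odot>\<^bsub>M\<^esub> x) = c \<odot>\<^bsub>N\<^esub> f x}"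

text \<open>Operations on cosets are written, as for \<^const>\<open>rcoset_mult\<close>, as unions over all
  representatives; when the operation is well defined this union is a single coset.\<close>

definition quotient_module ::
  "('k, 'x, 'm) module_scheme \<Rightarrow> 'x set \<Rightarrow> ('k, 'x set) module"
  where "quotient_module M N =
    \<lparr>carrier = a_rcosets\<^bsub>M\<^esub> N, mult = (\<lambda>_ _. undefined), one = undefined,
     zero = N, add = (\<lambda>C D. C <+>\<^bsub>M\<^esub> D),
     smult = (\<lambda>c C. \<Union>x\<in>C. N +>\<^bsub>M\<^esub> (c \<odot>\<^bsub>M\<^esub> x))\<rparr>"

definition induced_map ::
  "('y, 'n) ring_scheme \<Rightarrow> 'y set \<Rightarrow> ('x \<Rightarrow> 'y) \<Rightarrow> 'x set \<Rightarrow> 'y set"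
  where "induced_map M' N' f C = (\<Union>x\<in>C. N' +>\<^bsub>M'\<^esub> f x)"


section \<open>Derivations\<close>

text \<open>Maps defined on a carrier set are represented by extensional functions, so that equality
  of functions is equality of maps.\<close>

definition function_module ::
  "'a set \<Rightarrow> ('k, 'x, 'm) module_scheme \<Rightarrow> ('k, 'a \<Rightarrow> 'x) module"
  where "function_module S X =
    \<lparr>carrier = S \<rightarrow>\<^sub>E carrier X, mult = (\<lambda>_ _. undefined), one = undefined,
     zero = (\<lambda>s\<in>S. \<zero>\<^bsub>X\<^esub>), add = (\<lambda>f g. \<lambda>s\<in>S. f s \<oplus>\<^bsub>X\<^esub> g s),
     smult = (\<lambda>c f. \<lambda>s\<in>S. c \<odot>\<^bsub>X\<^esub> f s)\<rparr>"

definition derivations ::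
  "('k, 'r) ring_scheme \<Rightarrow> ('k, 'a, 'm) module_scheme \<Rightarrow> ('k, 'a, 'x, 'n) bimodule_scheme \<Rightarrow>
    ('a \<Rightarrow> 'x) set"
  where "derivations K A X = {D \<in> module_hom K A X \<inter> extensional (carrier A).
    \<forall>a \<in> carrier A. \<forall>b \<in> carrier A.
      D (a \<otimes>\<^bsub>A\<^esub> b) = (a \<triangleright>\<^bsub>X\<^esub> D b) \<oplus>\<^bsub>X\<^esub> (D a \<triangleleft>\<^bsub>X\<^esub> b)}"

definition relative_derivations ::
  "('k, 'r) ring_scheme \<Rightarrow> ('k, 'a, 'm) module_scheme \<Rightarrow> 'a set \<Rightarrow>
    ('k, 'a, 'x, 'n) bimodule_scheme \<Rightarrow> ('a \<Rightarrow> 'x) set"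
  where "relative_derivations K A B X = {D \<in> derivations K A X.
    \<forall>b \<in> B. \<forall>a \<in> carrier A.
      D (b \<otimes>\<^bsub>A\<^esub> a) = b \<triangleright>\<^bsub>X\<^esub> D a \<and> D (a \<otimes>\<^bsub>A\<^esub> b) = D a \<triangleleft>\<^bsub>X\<^esub> b}"

definition inner_derivation ::
  "('k, 'a, 'm) module_scheme \<Rightarrow> ('k, 'a, 'x, 'n) bimodule_scheme \<Rightarrow> 'x \<Rightarrow> 'a \<Rightarrow> 'x"
  where "inner_derivation A X x = (\<lambda>a\<in>carrier A. (x \<triangleleft>\<^bsub>X\<^esub> a) \<ominus>\<^bsub>X\<^esub> (a \<triangleright>\<^bsub>X\<^esub> x))"

definition invariants :: "'a set \<Rightarrow> ('k, 'a, 'x, 'n) bimodule_scheme \<Rightarrow> 'x set"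
  where "invariants B X = {x \<in> carrier X. \<forall>b \<in> B. b \<triangleright>\<^bsub>X\<^esub> x = x \<triangleleft>\<^bsub>X\<^esub> b}"

definition Der ::
  "('k, 'r) ring_scheme \<Rightarrow> ('k, 'a, 'm) module_scheme \<Rightarrow> ('k, 'a, 'x, 'n) bimodule_scheme \<Rightarrow>
    ('k, 'a \<Rightarrow> 'x) module"
  where "Der K A X = (function_module (carrier A) X)\<lparr>carrier := derivations K A X\<rparr>"

definition Inn ::
  "('k, 'a, 'm) module_scheme \<Rightarrow> ('k, 'a, 'x, 'n) bimodule_scheme \<Rightarrow> ('a \<Rightarrow> 'x) set"
  where "Inn A X = inner_derivation A X ` carrier X"

definition Der_rel ::
  "('k, 'r) ring_scheme \<Rightarrow> ('k, 'a, 'm) module_scheme \<Rightarrow> 'a set \<Rightarrow>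
    ('k, 'a, 'x, 'n) bimodule_scheme \<Rightarrow> ('k, 'a \<Rightarrow> 'x) module"
  where "Der_rel K A B X =
    (function_module (carrier A) X)\<lparr>carrier := relative_derivations K A B X\<rparr>"

definition Inn_rel ::
  "('k, 'a, 'm) module_scheme \<Rightarrow> 'a set \<Rightarrow> ('k, 'a, 'x, 'n) bimodule_scheme \<Rightarrow> ('a \<Rightarrow> 'x) set"
  where "Inn_rel A B X = inner_derivation A X ` invariants B X"


section \<open>First Hochschild cohomology, absolute and relative\<close>

definition H1 ::
  "('k, 'r) ring_scheme \<Rightarrow> ('k, 'a, 'm) module_scheme \<Rightarrow> ('k, 'a, 'x, 'n) bimodule_scheme \<Rightarrow>
    ('k, ('a \<Rightarrow> 'x) set) module"
  where "H1 K A X = quotient_module (Der K A X) (Inn A X)"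

definition H1_rel ::
  "('k, 'r) ring_scheme \<Rightarrow> ('k, 'a, 'm) module_scheme \<Rightarrow> 'a set \<Rightarrow>
    ('k, 'a, 'x, 'n) bimodule_scheme \<Rightarrow> ('k, ('a \<Rightarrow> 'x) set) module"
  where "H1_rel K A B X = quotient_module (Der_rel K A B X) (Inn_rel A B X)"

definition iota ::
  "('k, 'r) ring_scheme \<Rightarrow> ('k, 'a, 'm) module_scheme \<Rightarrow> ('k, 'a, 'x, 'n) bimodule_scheme \<Rightarrow>
    ('a \<Rightarrow> 'x) set \<Rightarrow> ('a \<Rightarrow> 'x) set"
  where "iota K A X = induced_map (Der K A X) (Inn A X) (\<lambda>D. D)"

text \<open>\<^term>\<open>A\<lparr>carrier := B\<rparr>\<close> is the subalgebra \<open>B\<close> as an algebra of its own, and the record \<open>X\<close>,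
  read over it, is the restricted \<open>B\<close>-bimodule.\<close>

definition kappa ::
  "('k, 'r) ring_scheme \<Rightarrow> ('k, 'a, 'm) module_scheme \<Rightarrow> 'a set \<Rightarrow>
    ('k, 'a, 'x, 'n) bimodule_scheme \<Rightarrow> ('a \<Rightarrow> 'x) set \<Rightarrow> ('a \<Rightarrow> 'x) set"
  where "kappa K A B X =
    induced_map (Der K (A\<lparr>carrier := B\<rparr>) X) (Inn (A\<lparr>carrier := B\<rparr>) X) (\<lambda>D. restrict D B)"

end

theory Submission
  imports Defs
begin

text \<open>
  Everything rests on one observation: a derivation \<open>D\<close> of \<open>A\<close> is relative to \<open>B\<close> if and only if
  it vanishes on \<open>B\<close> (\<open>relative_derivations_iff\<close>). One direction is the Leibniz rule; the other
  is \<open>D b = D (b 1) = b (D 1)\<close> together with \<open>D 1 = 0\<close>. Applied to an inner derivation, it says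
  that \<open>a \<mapsto> xa - ax\<close> is relative exactly when \<open>x\<close> commutes with \<open>B\<close>.

  Exactness at the first term: the relative derivations that become inner over \<open>A\<close> are the inner
  derivations that vanish on \<open>B\<close>, and these come from invariant elements (\<open>Inn_rel_eq\<close>).

  Exactness at the second term: a relative derivation restricts to zero on \<open>B\<close>, so the composite of
  the two maps is zero. Conversely, if \<open>D\<close> restricts on \<open>B\<close> to the inner derivation of some
  \<open>x \<in> X\<close>, then the same \<open>x\<close> defines an inner derivation of all of \<open>A\<close>, and subtracting it from
  \<open>D\<close> gives a derivation in the same class that vanishes on \<open>B\<close>, hence is relative
  (\<open>relative_representative\<close>).

  What remains is bookkeeping: quotients of modules by submodules are modules, linear maps that
  respect the submodules induce linear maps with the expected kernel, derivations form a module, and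
  inner derivations form a submodule because they are the image of \<open>X\<close> (or of its invariants) under
  a linear map.
\<close>


section \<open>Quotient modules and induced maps\<close>

lemma submodule_imp_abelian_subgroup:
  assumes "module K M" and "submodule N K M"
  shows "abelian_subgroup N M"
  by (meson assms abelian_subgroupI3 additive_subgroup.intro module_def submodule_def)

lemma (in abelian_subgroup) coset_eq_self_iff:
  "x \<in> carrier G \<Longrightarrow> H +>\<^bsub>G\<^esub> x = H \<longleftrightarrow> x \<in> H"
  using a_coset_join1 a_coset_join2 a_subgroup by blast

text \<open>The union that defines the induced map collapses to one coset: representatives of
  \<open>N + x\<close> differ by elements of \<open>N\<close>, whose images are absorbed by \<open>N'\<close>.\<close>

lemma induced_map_coset:
  assumes N: "abelian_subgroup N M" and N': "abelian_subgroup N' M'"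
    and f: "f \<in> hom (add_monoid M) (add_monoid M')" and fN: "f ` N \<subseteq> N'"
    and x: "x \<in> carrier M"
  shows "induced_map M' N' f (N +>\<^bsub>M\<^esub> x) = N' +>\<^bsub>M'\<^esub> f x"
proof -
  interpret N: abelian_subgroup N M by (rule N)
  interpret N': abelian_subgroup N' M' by (rule N')
  have fx: "f x \<in> carrier M'"
    using f x by (auto simp: hom_def)
  have "N' +>\<^bsub>M'\<^esub> f y = N' +>\<^bsub>M'\<^esub> f x" if y: "y \<in> N +>\<^bsub>M\<^esub> x" for y
  proof -
    obtain n where n: "n \<in> N" "y = n \<oplus>\<^bsub>M\<^esub> x"
      using y by (auto simp: a_r_coset_def')
    have "f y = f n \<oplus>\<^bsub>M'\<^esub> f x"
      using f n x N.a_subset by (auto simp: hom_def)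
    then have "f y \<in> N' +>\<^bsub>M'\<^esub> f x"
      using n fN by (auto simp: a_r_coset_def')
    then show ?thesis
      using N'.a_repr_independence fx N'.a_subgroup by blast
  qed
  moreover have "x \<in> N +>\<^bsub>M\<^esub> x"
    using N.a_rcos_self x by blast
  ultimately show ?thesis
    unfolding induced_map_def by blast
qed

lemma carrier_quotient_module:
  "carrier (quotient_module M N) = (\<lambda>x. N +>\<^bsub>M\<^esub> x) ` carrier M"
  by (auto simp: quotient_module_def A_RCOSETS_def' a_r_coset_def')

text \<open>Scalar multiplication on the quotient is the map induced by the endomorphism
  \<open>x \<mapsto> c x\<close>, so that independence of representatives is already settled.\<close>

lemma smult_quotient_module:
  assumes M: "module K M" and N: "submodule N K M"
    and c: "c \<in> carrier K" and x: "x \<in> carrier M"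
  shows "c \<odot>\<^bsub>quotient_module M N\<^esub> (N +>\<^bsub>M\<^esub> x) = N +>\<^bsub>M\<^esub> (c \<odot>\<^bsub>M\<^esub> x)"
proof -
  interpret M: module K M by (rule M)
  have "(\<lambda>x. c \<odot>\<^bsub>M\<^esub> x) \<in> hom (add_monoid M) (add_monoid M)"
    using c by (auto simp: hom_def M.smult_r_distr)
  moreover have "(\<lambda>x. c \<odot>\<^bsub>M\<^esub> x) ` N \<subseteq> N"
    using submodule.smult_closed[OF N c] by blast
  ultimately have "induced_map M N (\<lambda>x. c \<odot>\<^bsub>M\<^esub> x) (N +>\<^bsub>M\<^esub> x) = N +>\<^bsub>M\<^esub> (c \<odot>\<^bsub>M\<^esub> x)"
    using induced_map_coset submodule_imp_abelian_subgroup M N x by metis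
  then show ?thesis
    by (simp add: quotient_module_def induced_map_def)
qed

lemma quotient_module_is_module:
  assumes M: "module K M" and N: "submodule N K M"
  shows "module K (quotient_module M N)"
proof -
  interpret M: module K M by (rule M)
  interpret N: abelian_subgroup N M
    by (rule submodule_imp_abelian_subgroup[OF M N])
  let ?Q = "quotient_module M N"
  have add: "(N +>\<^bsub>M\<^esub> x) \<oplus>\<^bsub>?Q\<^esub> (N +>\<^bsub>M\<^esub> y) = N +>\<^bsub>M\<^esub> (x \<oplus>\<^bsub>M\<^esub> y)"
    if "x \<in> carrier M" "y \<in> carrier M" for x y
    using that by (simp add: quotient_module_def N.a_rcos_sum)
  note smult = smult_quotient_module[OF M N]
  have zero: "\<zero>\<^bsub>?Q\<^esub> = N +>\<^bsub>M\<^esub> \<zero>\<^bsub>M\<^esub>"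
    using N.a_subset by (simp add: quotient_module_def)
  show ?thesis
  proof (rule moduleI)
    show "abelian_group ?Q"
    proof (rule abelian_groupI)
      fix C assume "C \<in> carrier ?Q"
      then obtain x where x: "x \<in> carrier M" "C = N +>\<^bsub>M\<^esub> x"
        by (auto simp: carrier_quotient_module)
      then have "(N +>\<^bsub>M\<^esub> (\<ominus>\<^bsub>M\<^esub> x)) \<oplus>\<^bsub>?Q\<^esub> C = \<zero>\<^bsub>?Q\<^esub>"
        by (simp add: add zero M.M.l_neg)
      then show "\<exists>C'\<in>carrier ?Q. C' \<oplus>\<^bsub>?Q\<^esub> C = \<zero>\<^bsub>?Q\<^esub>"
        using x by (auto simp: carrier_quotient_module)
    qed (auto simp: carrier_quotient_module add zero M.M.a_ac)
  qed (auto simp: M.is_cring carrier_quotient_module add smult M.smult_l_distr M.smult_r_distr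
      M.smult_assoc1)
qed

lemma induced_map_module_hom:
  assumes M: "module K M" and N: "submodule N K M"
    and M': "module K M'" and N': "submodule N' K M'"
    and f: "f \<in> module_hom K M M'" and fN: "f ` N \<subseteq> N'"
  shows "induced_map M' N' f \<in> module_hom K (quotient_module M N) (quotient_module M' N')"
proof -
  interpret M: module K M by (rule M)
  interpret N: abelian_subgroup N M
    by (rule submodule_imp_abelian_subgroup[OF M N])
  interpret N': abelian_subgroup N' M'
    by (rule submodule_imp_abelian_subgroup[OF M' N'])
  have hom: "f \<in> hom (add_monoid M) (add_monoid M')"
    using f by (simp add: module_hom_def)
  have closed: "f x \<in> carrier M'" if "x \<in> carrier M" for x
    using hom that by (auto simp: hom_def)
  have add: "f (x \<oplus>\<^bsub>M\<^esub> y) = f x \<oplus>\<^bsub>M'\<^esub> f y" if "x \<in> carrier M" "y \<in> carrier M" for x y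
    using hom that by (auto simp: hom_def)
  have smult: "f (c \<odot>\<^bsub>M\<^esub> x) = c \<odot>\<^bsub>M'\<^esub> f x" if "c \<in> carrier K" "x \<in> carrier M" for c x
    using f that by (auto simp: module_hom_def)
  have sum: "C <+>\<^bsub>M\<^esub> D = C \<oplus>\<^bsub>quotient_module M N\<^esub> D"
    "C' <+>\<^bsub>M'\<^esub> D' = C' \<oplus>\<^bsub>quotient_module M' N'\<^esub> D'" for C D C' D'
    by (simp_all add: quotient_module_def)
  note coset = induced_map_coset[OF N.is_abelian_subgroup N'.is_abelian_subgroup hom fN]
  show ?thesis
    unfolding module_hom_def hom_def
    by (auto simp: carrier_quotient_module coset closed add smult smult_quotient_module[OF M N]
        smult_quotient_module[OF M' N'] simp flip: sum simp: N.a_rcos_sum N'.a_rcos_sum)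
qed

text \<open>This turns both exactness claims into statements about representatives.\<close>

lemma a_kernel_induced_map:
  assumes M: "module K M" and N: "submodule N K M"
    and M': "module K M'" and N': "submodule N' K M'"
    and f: "f \<in> module_hom K M M'" and fN: "f ` N \<subseteq> N'"
  shows "a_kernel (quotient_module M N) (quotient_module M' N') (induced_map M' N' f)
    = (\<lambda>x. N +>\<^bsub>M\<^esub> x) ` {x \<in> carrier M. f x \<in> N'}"
proof -
  interpret N: abelian_subgroup N M
    by (rule submodule_imp_abelian_subgroup[OF M N])
  interpret N': abelian_subgroup N' M'
    by (rule submodule_imp_abelian_subgroup[OF M' N'])
  have hom: "f \<in> hom (add_monoid M) (add_monoid M')"
    using f by (simp add: module_hom_def)
  note coset = induced_map_coset[OF N.is_abelian_subgroup N'.is_abelian_subgroup hom fN]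
  have "induced_map M' N' f (N +>\<^bsub>M\<^esub> x) = N' \<longleftrightarrow> f x \<in> N'" if "x \<in> carrier M" for x
  proof -
    have "f x \<in> carrier M'"
      using that hom by (auto simp: hom_def)
    then show ?thesis
      using that by (simp add: coset N'.coset_eq_self_iff)
  qed
  moreover have "\<zero>\<^bsub>quotient_module M' N'\<^esub> = N'"
    by (simp add: quotient_module_def)
  ultimately show ?thesis
    unfolding a_kernel_def' carrier_quotient_module by auto
qed

lemma submodule_of_carrier_update:
  assumes "module K M" and "submodule C K M" and "submodule N K M" and "N \<subseteq> C"
  shows "submodule N K (M\<lparr>carrier := C\<rparr>)"
proof -
  have "module K (M\<lparr>carrier := C\<rparr>\<lparr>carrier := N\<rparr>)"
    using submodule.submodule_is_module[OF assms(3,1)] by simp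
  then show ?thesis
    using module.module_incl_imp_submodule[OF submodule.submodule_is_module[OF assms(2,1)]] assms(4)
    by simp
qed

lemma module_hom_image_submodule:
  assumes M: "module K M" and M': "module K M'" and f: "f \<in> module_hom K M M'"
    and N: "submodule N K M"
  shows "submodule (f ` N) K M'"
proof -
  interpret M: module K M by (rule M)
  interpret M': module K M' by (rule M')
  interpret N: submodule N K M by (rule N)
  have "group_hom (add_monoid M) (add_monoid M') f"
    using f M.M.a_group M'.M.a_group
    by (simp add: module_hom_def group_hom_def group_hom_axioms_def)
  then have "subgroup (f ` N) (add_monoid M')"
    using group_hom.subgroup_img_is_subgroup N.subgroup_axioms by blast
  moreover have "c \<odot>\<^bsub>M'\<^esub> f x \<in> f ` N" if "c \<in> carrier K" "x \<in> N" for c x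
  proof -
    have "c \<odot>\<^bsub>M'\<^esub> f x = f (c \<odot>\<^bsub>M\<^esub> x)"
      using f that N.subset by (auto simp: module_hom_def)
    then show ?thesis using that by auto
  qed
  ultimately show ?thesis
    by (auto intro!: submodule.intro submodule_axioms.intro)
qed


section \<open>Modules of derivations\<close>

lemma function_module_is_module:
  assumes "module K X"
  shows "module K (function_module S X)"
proof -
  interpret X: module K X by (rule assms)
  show ?thesis
  proof (rule moduleI)
    show "abelian_group (function_module S X)"
    proof (rule abelian_groupI)
      fix f assume f: "f \<in> carrier (function_module S X)"
      then have "(\<lambda>s\<in>S. \<ominus>\<^bsub>X\<^esub> f s) \<oplus>\<^bsub>function_module S X\<^esub> f = \<zero>\<^bsub>function_module S X\<^esub>"
        by (auto simp: function_module_def fun_eq_iff PiE_def Pi_def X.M.l_neg)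
      moreover have "(\<lambda>s\<in>S. \<ominus>\<^bsub>X\<^esub> f s) \<in> carrier (function_module S X)"
        using f by (auto simp: function_module_def)
      ultimately show "\<exists>g\<in>carrier (function_module S X).
          g \<oplus>\<^bsub>function_module S X\<^esub> f = \<zero>\<^bsub>function_module S X\<^esub>"
        by blast
    qed (auto simp: function_module_def fun_eq_iff PiE_def Pi_def extensional_def X.M.a_ac)
  qed (auto simp: X.is_cring function_module_def fun_eq_iff PiE_def Pi_def extensional_def
      X.smult_l_distr X.smult_r_distr X.smult_assoc1)
qed

lemma uminus_function_module:
  assumes "module K X" and f: "f \<in> S \<rightarrow>\<^sub>E carrier X"
  shows "\<ominus>\<^bsub>function_module S X\<^esub> f = (\<lambda>s\<in>S. \<ominus>\<^bsub>X\<^esub> f s)"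
proof -
  interpret X: module K X by (rule assms)
  interpret F: module K "function_module S X"
    by (rule function_module_is_module[OF assms(1)])
  have "(\<lambda>s\<in>S. \<ominus>\<^bsub>X\<^esub> f s) \<oplus>\<^bsub>function_module S X\<^esub> f = \<zero>\<^bsub>function_module S X\<^esub>"
    using f by (auto simp: function_module_def fun_eq_iff PiE_def Pi_def X.M.l_neg)
  moreover have "(\<lambda>s\<in>S. \<ominus>\<^bsub>X\<^esub> f s) \<in> carrier (function_module S X)"
    "f \<in> carrier (function_module S X)"
    using f by (auto simp: function_module_def)
  ultimately show ?thesis
    using F.M.minus_equality by blast
qed

lemma derivations_iff:
  "D \<in> derivations K A X \<longleftrightarrow> D \<in> carrier A \<rightarrow>\<^sub>E carrier X
    \<and> (\<forall>a\<in>carrier A. \<forall>b\<in>carrier A. D (a \<oplus>\<^bsub>A\<^esub> b) = D a \<oplus>\<^bsub>X\<^esub> D b)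
    \<and> (\<forall>c\<in>carrier K. \<forall>a\<in>carrier A. D (c \<odot>\<^bsub>A\<^esub> a) = c \<odot>\<^bsub>X\<^esub> D a)
    \<and> (\<forall>a\<in>carrier A. \<forall>b\<in>carrier A.
        D (a \<otimes>\<^bsub>A\<^esub> b) = (a \<triangleright>\<^bsub>X\<^esub> D b) \<oplus>\<^bsub>X\<^esub> (D a \<triangleleft>\<^bsub>X\<^esub> b))"
  by (auto simp: derivations_def module_hom_def hom_def PiE_def)

context bimodule
begin

lemma lact_zero: "a \<in> carrier A \<Longrightarrow> a \<triangleright>\<^bsub>X\<^esub> \<zero>\<^bsub>X\<^esub> = \<zero>\<^bsub>X\<^esub>"
  using lact_add_right[of a "\<zero>\<^bsub>X\<^esub>" "\<zero>\<^bsub>X\<^esub>"] lact_closed[of a "\<zero>\<^bsub>X\<^esub>"]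
  by (simp add: X.M.add.l_cancel_one')

lemma ract_zero: "a \<in> carrier A \<Longrightarrow> \<zero>\<^bsub>X\<^esub> \<triangleleft>\<^bsub>X\<^esub> a = \<zero>\<^bsub>X\<^esub>"
  using ract_add_left[of a "\<zero>\<^bsub>X\<^esub>" "\<zero>\<^bsub>X\<^esub>"] ract_closed[of a "\<zero>\<^bsub>X\<^esub>"]
  by (simp add: X.M.add.l_cancel_one')

lemma lact_uminus:
  assumes "a \<in> carrier A" "x \<in> carrier X"
  shows "a \<triangleright>\<^bsub>X\<^esub> (\<ominus>\<^bsub>X\<^esub> x) = \<ominus>\<^bsub>X\<^esub> (a \<triangleright>\<^bsub>X\<^esub> x)"
proof (rule X.M.minus_equality[symmetric])
  show "a \<triangleright>\<^bsub>X\<^esub> (\<ominus>\<^bsub>X\<^esub> x) \<oplus>\<^bsub>X\<^esub> (a \<triangleright>\<^bsub>X\<^esub> x) = \<zero>\<^bsub>X\<^esub>"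
    using assms lact_add_right[of a "\<ominus>\<^bsub>X\<^esub> x" x] by (simp add: X.M.l_neg lact_zero)
qed (use assms in \<open>auto intro: lact_closed\<close>)

lemma ract_uminus:
  assumes "a \<in> carrier A" "x \<in> carrier X"
  shows "(\<ominus>\<^bsub>X\<^esub> x) \<triangleleft>\<^bsub>X\<^esub> a = \<ominus>\<^bsub>X\<^esub> (x \<triangleleft>\<^bsub>X\<^esub> a)"
proof (rule X.M.minus_equality[symmetric])
  show "(\<ominus>\<^bsub>X\<^esub> x) \<triangleleft>\<^bsub>X\<^esub> a \<oplus>\<^bsub>X\<^esub> (x \<triangleleft>\<^bsub>X\<^esub> a) = \<zero>\<^bsub>X\<^esub>"
    using assms ract_add_left[of a "\<ominus>\<^bsub>X\<^esub> x" x] by (simp add: X.M.l_neg ract_zero)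
qed (use assms in \<open>auto intro: ract_closed\<close>)

lemmas act_simps = lact_closed ract_closed lact_add_left lact_add_right ract_add_left ract_add_right
  lact_smult_left lact_smult_right ract_smult_left ract_smult_right lact_uminus ract_uminus
  lact_assoc ract_assoc lact_ract_assoc lact_zero ract_zero

lemma derivations_submodule:
  "submodule (derivations K A X) K (function_module (carrier A) X)"
proof -
  interpret F: module K "function_module (carrier A) X"
    by (rule function_module_is_module) unfold_locales
  show ?thesis
  proof (rule F.submoduleI)
    fix D assume D: "D \<in> derivations K A X"
    then have "(\<lambda>a\<in>carrier A. \<ominus>\<^bsub>X\<^esub> D a) \<in> derivations K A X"
      by (auto simp: derivations_iff PiE_iff act_simps X.M.minus_add X.smult_r_minus)
    moreover have "\<ominus>\<^bsub>function_module (carrier A) X\<^esub> D = (\<lambda>a\<in>carrier A. \<ominus>\<^bsub>X\<^esub> D a)"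
      using D by (intro uminus_function_module[OF X.module_axioms]) (simp add: derivations_iff)
    ultimately show "\<ominus>\<^bsub>function_module (carrier A) X\<^esub> D \<in> derivations K A X"
      by simp
  next
    fix D E assume "D \<in> derivations K A X" "E \<in> derivations K A X"
    then show "D \<oplus>\<^bsub>function_module (carrier A) X\<^esub> E \<in> derivations K A X"
      by (simp add: derivations_iff function_module_def PiE_iff act_simps X.M.a_ac X.smult_r_distr)
  next
    fix c D assume c: "c \<in> carrier K" and D: "D \<in> derivations K A X"
    have "c \<odot>\<^bsub>X\<^esub> (d \<odot>\<^bsub>X\<^esub> x) = d \<odot>\<^bsub>X\<^esub> (c \<odot>\<^bsub>X\<^esub> x)" if "d \<in> carrier K" "x \<in> carrier X" for d x
      using c that X.smult_assoc1[of c d x] X.smult_assoc1[of d c x] m_comm[of c d] by simp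
    then show "c \<odot>\<^bsub>function_module (carrier A) X\<^esub> D \<in> derivations K A X"
      using c D by (simp add: derivations_iff function_module_def PiE_iff act_simps X.smult_r_distr)
  qed (auto simp: derivations_iff function_module_def PiE_iff extensional_def act_simps)
qed

lemma Der_module: "module K (Der K A X)"
  unfolding Der_def
  by (rule submodule.submodule_is_module[OF derivations_submodule
        function_module_is_module[OF X.module_axioms]])

text \<open>In the Leibniz rule the terms \<open>a x b\<close>, once with each sign, cancel.\<close>

lemma inner_derivation_in_derivations:
  assumes x: "x \<in> carrier X"
  shows "inner_derivation A X x \<in> derivations K A X"
  unfolding derivations_iff
proof (intro conjI ballI)
  show "inner_derivation A X x \<in> carrier A \<rightarrow>\<^sub>E carrier X"
    using x by (auto simp: inner_derivation_def act_simps)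
next
  fix a b assume ab: "a \<in> carrier A" "b \<in> carrier A"
  then show "inner_derivation A X x (a \<oplus>\<^bsub>A\<^esub> b)
      = inner_derivation A X x a \<oplus>\<^bsub>X\<^esub> inner_derivation A X x b"
    using x by (simp add: inner_derivation_def act_simps a_minus_def X.M.minus_add X.M.a_ac)
  show "inner_derivation A X x (a \<otimes>\<^bsub>A\<^esub> b)
      = (a \<triangleright>\<^bsub>X\<^esub> inner_derivation A X x b) \<oplus>\<^bsub>X\<^esub> (inner_derivation A X x a \<triangleleft>\<^bsub>X\<^esub> b)"
  proof -
    have cancel: "p \<ominus>\<^bsub>X\<^esub> q = (r \<ominus>\<^bsub>X\<^esub> q) \<oplus>\<^bsub>X\<^esub> (p \<ominus>\<^bsub>X\<^esub> r)"
      if "p \<in> carrier X" "q \<in> carrier X" "r \<in> carrier X" for p q r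
    proof -
      have "(r \<ominus>\<^bsub>X\<^esub> q) \<oplus>\<^bsub>X\<^esub> (p \<ominus>\<^bsub>X\<^esub> r) = r \<oplus>\<^bsub>X\<^esub> (\<ominus>\<^bsub>X\<^esub> r \<oplus>\<^bsub>X\<^esub> (p \<ominus>\<^bsub>X\<^esub> q))"
        using that by (simp add: a_minus_def X.M.a_ac)
      then show ?thesis
        using that by (simp add: X.M.r_neg2)
    qed
    show ?thesis
      using x ab cancel[of "x \<triangleleft>\<^bsub>X\<^esub> a \<triangleleft>\<^bsub>X\<^esub> b" "a \<triangleright>\<^bsub>X\<^esub> b \<triangleright>\<^bsub>X\<^esub> x" "a \<triangleright>\<^bsub>X\<^esub> (x \<triangleleft>\<^bsub>X\<^esub> b)"]
      by (simp add: inner_derivation_def act_simps a_minus_def)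
  qed
next
  fix c a assume "c \<in> carrier K" "a \<in> carrier A"
  then show "inner_derivation A X x (c \<odot>\<^bsub>A\<^esub> a) = c \<odot>\<^bsub>X\<^esub> inner_derivation A X x a"
    using x by (simp add: inner_derivation_def act_simps a_minus_def X.smult_r_distr
        X.smult_r_minus)
qed

lemma inner_derivation_hom: "inner_derivation A X \<in> module_hom K X (Der K A X)"
proof -
  have "inner_derivation A X (x \<oplus>\<^bsub>X\<^esub> y)
      = inner_derivation A X x \<oplus>\<^bsub>Der K A X\<^esub> inner_derivation A X y"
    if "x \<in> carrier X" "y \<in> carrier X" for x y
    unfolding inner_derivation_def Der_def function_module_def
    using that by (simp cong: restrict_cong add: act_simps a_minus_def X.M.minus_add X.M.a_ac)
  moreover have "inner_derivation A X (c \<odot>\<^bsub>X\<^esub> x) = c \<odot>\<^bsub>Der K A X\<^esub> inner_derivation A X x"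
    if "c \<in> carrier K" "x \<in> carrier X" for c x
    unfolding inner_derivation_def Der_def function_module_def
    using that
    by (simp cong: restrict_cong add: act_simps a_minus_def X.smult_r_distr X.smult_r_minus)
  ultimately show ?thesis
    using inner_derivation_in_derivations by (simp add: module_hom_def hom_def Der_def)
qed

lemma Inn_submodule: "submodule (Inn A X) K (Der K A X)"
  unfolding Inn_def
  by (rule module_hom_image_submodule[OF X.module_axioms Der_module inner_derivation_hom
        X.carrier_is_submodule])

lemma H1_module: "module K (H1 K A X)"
  unfolding H1_def by (rule quotient_module_is_module[OF Der_module Inn_submodule])

text \<open>Since \<open>D 1 = D (1 1) = D 1 + D 1\<close>.\<close>

lemma derivation_one:
  assumes D: "D \<in> derivations K A X"
  shows "D \<one>\<^bsub>A\<^esub> = \<zero>\<^bsub>X\<^esub>"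
proof -
  have "D \<one>\<^bsub>A\<^esub> \<in> carrier X"
    using D by (auto simp: derivations_iff)
  moreover have "D (\<one>\<^bsub>A\<^esub> \<otimes>\<^bsub>A\<^esub> \<one>\<^bsub>A\<^esub>) = (\<one>\<^bsub>A\<^esub> \<triangleright>\<^bsub>X\<^esub> D \<one>\<^bsub>A\<^esub>) \<oplus>\<^bsub>X\<^esub> (D \<one>\<^bsub>A\<^esub> \<triangleleft>\<^bsub>X\<^esub> \<one>\<^bsub>A\<^esub>)"
    using D unfolding derivations_iff by blast
  ultimately show ?thesis
    by (simp add: lact_one ract_one X.M.add.l_cancel_one')
qed

end


section \<open>Restriction to a subalgebra\<close>

locale bimodule_over_subalgebra = bimodule K A X + sub: unital_subalgebra B K A
  for K (structure) and A :: "('k, 'a, 'm) module_scheme" (structure)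
    and X :: "('k, 'a, 'x, 'n) bimodule_scheme" (structure) and B
begin

lemma subalgebra_assoc_algebra: "assoc_algebra K (A\<lparr>carrier := B\<rparr>)"
proof -
  have A: "module K A" and ringA: "ring A"
    by unfold_locales
  interpret B: module K "A\<lparr>carrier := B\<rparr>"
    by (rule sub.submodule_is_module[OF A])
  have "subgroup B (add_monoid A)"
    by unfold_locales
  then have "subring B A"
    by (intro subring.intro sub.submonoid_axioms)
  then have "ring (A\<lparr>carrier := B\<rparr>)"
    using ring.subring_is_ring[OF ringA] by blast
  then show ?thesis
    using field_axioms B.module_axioms sub.subset
    by (intro assoc_algebra.intro assoc_algebra_axioms.intro)
      (auto simp: smult_mult_left smult_mult_right)
qed

lemma restricted_bimodule: "bimodule K (A\<lparr>carrier := B\<rparr>) X"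
  using sub.subset
  by (intro bimodule.intro bimodule_axioms.intro subalgebra_assoc_algebra X.module_axioms)
    (auto simp: act_simps lact_one ract_one subset_iff)

sublocale restr: bimodule K "A\<lparr>carrier := B\<rparr>" X
  by (rule restricted_bimodule)

text \<open>On \<open>B\<close> a relative derivation is \<open>b \<mapsto> b (D 1) = 0\<close>; conversely, if \<open>D\<close> kills \<open>B\<close>, one of the
  two terms of the Leibniz rule for \<open>b a\<close> and for \<open>a b\<close> disappears. The criterion replaces
  \<open>B\<close>-bilinearity by a pointwise condition that visibly passes to sums and multiples.\<close>

lemma relative_derivations_iff:
  "D \<in> relative_derivations K A B X \<longleftrightarrow> D \<in> derivations K A X \<and> (\<forall>b\<in>B. D b = \<zero>\<^bsub>X\<^esub>)"
proof (intro iffI conjI ballI)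
  assume D: "D \<in> relative_derivations K A B X"
  then show der: "D \<in> derivations K A X"
    by (simp add: relative_derivations_def)
  fix b assume b: "b \<in> B"
  then have bA: "b \<in> carrier A"
    using sub.subset by auto
  have "D b = D (b \<otimes>\<^bsub>A\<^esub> \<one>\<^bsub>A\<^esub>)"
    using bA by simp
  also have "\<dots> = b \<triangleright>\<^bsub>X\<^esub> D \<one>\<^bsub>A\<^esub>"
    using D b unfolding relative_derivations_def by blast
  finally show "D b = \<zero>\<^bsub>X\<^esub>"
    using der bA by (simp add: derivation_one lact_zero)
next
  assume "D \<in> derivations K A X \<and> (\<forall>b\<in>B. D b = \<zero>\<^bsub>X\<^esub>)"
  then show "D \<in> relative_derivations K A B X"
    using sub.subset
    by (auto simp: relative_derivations_def derivations_iff PiE_iff subset_iff act_simps)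
qed

lemma inner_derivation_relative_iff:
  assumes x: "x \<in> carrier X"
  shows "inner_derivation A X x \<in> relative_derivations K A B X \<longleftrightarrow> x \<in> invariants B X"
proof -
  have "inner_derivation A X x b = \<zero>\<^bsub>X\<^esub> \<longleftrightarrow> b \<triangleright>\<^bsub>X\<^esub> x = x \<triangleleft>\<^bsub>X\<^esub> b" if "b \<in> B" for b
  proof -
    have "b \<in> carrier A"
      using that sub.subset by auto
    then show ?thesis
      using x X.M.add.inv_solve_right'[of "\<zero>\<^bsub>X\<^esub>" "x \<triangleleft>\<^bsub>X\<^esub> b" "b \<triangleright>\<^bsub>X\<^esub> x"]
      by (auto simp: inner_derivation_def act_simps a_minus_def a_inv_def)
  qed
  then show ?thesis
    using x by (auto simp: relative_derivations_iff inner_derivation_in_derivations invariants_def)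
qed

lemma invariants_submodule: "submodule (invariants B X) K X"
  using sub.subset
  by (intro X.submoduleI) (auto simp: invariants_def act_simps subset_iff)

lemma relative_derivations_submodule: "submodule (relative_derivations K A B X) K (Der K A X)"
proof -
  let ?F = "function_module (carrier A) X"
  interpret F: module K ?F
    by (rule function_module_is_module[OF X.module_axioms])
  note D = F.submoduleE[OF derivations_submodule]
  have "submodule (relative_derivations K A B X) K ?F"
  proof (rule F.submoduleI)
    show "relative_derivations K A B X \<subseteq> carrier ?F"
      using D(1) by (auto simp: relative_derivations_iff)
  next
    have "\<zero>\<^bsub>?F\<^esub> \<in> derivations K A X"
      using subgroup.one_closed[OF submodule.axioms(1)[OF derivations_submodule]] by simp
    then show "\<zero>\<^bsub>?F\<^esub> \<in> relative_derivations K A B X"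
      using sub.subset by (auto simp: relative_derivations_iff function_module_def)
  next
    fix E assume E: "E \<in> relative_derivations K A B X"
    then have "\<ominus>\<^bsub>?F\<^esub> E = (\<lambda>a\<in>carrier A. \<ominus>\<^bsub>X\<^esub> E a)"
      by (intro uminus_function_module[OF X.module_axioms])
        (simp add: relative_derivations_iff derivations_iff)
    moreover have "\<ominus>\<^bsub>?F\<^esub> E \<in> derivations K A X"
      using E D(3) by (simp add: relative_derivations_iff)
    ultimately show "\<ominus>\<^bsub>?F\<^esub> E \<in> relative_derivations K A B X"
      using E sub.subset by (auto simp: relative_derivations_iff)
  next
    fix E E' assume E: "E \<in> relative_derivations K A B X" "E' \<in> relative_derivations K A B X"
    then have "E \<oplus>\<^bsub>?F\<^esub> E' \<in> derivations K A X"
      using D(5) by (simp add: relative_derivations_iff)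
    then show "E \<oplus>\<^bsub>?F\<^esub> E' \<in> relative_derivations K A B X"
      using E sub.subset by (auto simp: relative_derivations_iff function_module_def)
  next
    fix c E assume E: "c \<in> carrier K" "E \<in> relative_derivations K A B X"
    then have "c \<odot>\<^bsub>?F\<^esub> E \<in> derivations K A X"
      using D(4) by (simp add: relative_derivations_iff)
    then show "c \<odot>\<^bsub>?F\<^esub> E \<in> relative_derivations K A B X"
      using E sub.subset by (auto simp: relative_derivations_iff function_module_def)
  qed
  then show ?thesis
    unfolding Der_def
    by (intro submodule_of_carrier_update[OF F.module_axioms derivations_submodule])
      (auto simp: relative_derivations_iff)
qed

lemma Der_rel_eq: "Der_rel K A B X = (Der K A X)\<lparr>carrier := relative_derivations K A B X\<rparr>"
  by (simp add: Der_rel_def Der_def)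

lemma Der_rel_module: "module K (Der_rel K A B X)"
  unfolding Der_rel_eq
  by (rule submodule.submodule_is_module[OF relative_derivations_submodule Der_module])

text \<open>The injectivity of \<^const>\<open>iota\<close> on the level of derivations.\<close>

lemma Inn_rel_eq: "Inn_rel A B X = Inn A X \<inter> relative_derivations K A B X"
  using inner_derivation_relative_iff
  by (auto simp: Inn_rel_def Inn_def invariants_def)

lemma Inn_rel_submodule: "submodule (Inn_rel A B X) K (Der_rel K A B X)"
  unfolding Der_rel_eq
proof (rule submodule_of_carrier_update[OF Der_module relative_derivations_submodule])
  show "submodule (Inn_rel A B X) K (Der K A X)"
    unfolding Inn_rel_def
    by (rule module_hom_image_submodule[OF X.module_axioms Der_module inner_derivation_hom
          invariants_submodule])
qed (simp add: Inn_rel_eq)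

lemma H1_rel_module: "module K (H1_rel K A B X)"
  unfolding H1_rel_def by (rule quotient_module_is_module[OF Der_rel_module Inn_rel_submodule])


section \<open>Exactness\<close>

lemma inclusion_hom: "(\<lambda>D. D) \<in> module_hom K (Der_rel K A B X) (Der K A X)"
  by (auto simp: module_hom_def hom_def Der_rel_eq) (auto simp: relative_derivations_iff Der_def)

lemma restrict_hom:
  "(\<lambda>D. restrict D B) \<in> module_hom K (Der K A X) (Der K (A\<lparr>carrier := B\<rparr>) X)"
proof -
  have "a \<oplus>\<^bsub>A\<^esub> b \<in> B" "a \<otimes>\<^bsub>A\<^esub> b \<in> B" if "a \<in> B" "b \<in> B" for a b
    using that subgroup.m_closed[OF sub.subgroup_axioms] submonoid.m_closed[OF sub.submonoid_axioms]
    by auto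
  then have "restrict D B \<in> derivations K (A\<lparr>carrier := B\<rparr>) X" if "D \<in> derivations K A X" for D
    using that sub.subset sub.smult_closed by (auto simp: derivations_iff PiE_iff subset_iff)
  then show ?thesis
    using sub.subset
    by (auto simp: module_hom_def hom_def Der_def)
      (auto simp: function_module_def fun_eq_iff)
qed

lemma restrict_inner_derivation:
  "restrict (inner_derivation A X x) B = inner_derivation (A\<lparr>carrier := B\<rparr>) X x"
  using sub.subset by (auto simp: inner_derivation_def fun_eq_iff)

lemma restrict_Inn: "(\<lambda>D. restrict D B) ` Inn A X \<subseteq> Inn (A\<lparr>carrier := B\<rparr>) X"
  by (auto simp: Inn_def restrict_inner_derivation)

lemma iota_coset:
  assumes "D \<in> relative_derivations K A B X"
  shows "iota K A X (Inn_rel A B X +>\<^bsub>Der_rel K A B X\<^esub> D) = Inn A X +>\<^bsub>Der K A X\<^esub> D"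
  unfolding iota_def
proof (rule induced_map_coset)
  show "abelian_subgroup (Inn_rel A B X) (Der_rel K A B X)"
    by (rule submodule_imp_abelian_subgroup[OF Der_rel_module Inn_rel_submodule])
  show "abelian_subgroup (Inn A X) (Der K A X)"
    by (rule submodule_imp_abelian_subgroup[OF Der_module Inn_submodule])
  show "(\<lambda>D. D) \<in> hom (add_monoid (Der_rel K A B X)) (add_monoid (Der K A X))"
    using inclusion_hom by (simp add: module_hom_def)
  show "(\<lambda>D. D) ` Inn_rel A B X \<subseteq> Inn A X"
    by (auto simp: Inn_rel_eq)
  show "D \<in> carrier (Der_rel K A B X)"
    using assms by (simp add: Der_rel_def)
qed

lemma iota_hom: "iota K A X \<in> module_hom K (H1_rel K A B X) (H1 K A X)"
  unfolding iota_def H1_rel_def H1_def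
  by (rule induced_map_module_hom[OF Der_rel_module Inn_rel_submodule Der_module Inn_submodule
        inclusion_hom]) (auto simp: Inn_rel_eq)

lemma kappa_hom: "kappa K A B X \<in> module_hom K (H1 K A X) (H1 K (A\<lparr>carrier := B\<rparr>) X)"
  unfolding kappa_def H1_def
  by (rule induced_map_module_hom[OF Der_module Inn_submodule restr.Der_module restr.Inn_submodule
        restrict_hom restrict_Inn])

lemma kernel_iota: "a_kernel (H1_rel K A B X) (H1 K A X) (iota K A X) = {\<zero>\<^bsub>H1_rel K A B X\<^esub>}"
proof -
  interpret N: abelian_subgroup "Inn_rel A B X" "Der_rel K A B X"
    by (rule submodule_imp_abelian_subgroup[OF Der_rel_module Inn_rel_submodule])
  have "a_kernel (H1_rel K A B X) (H1 K A X) (iota K A X)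
      = (\<lambda>D. Inn_rel A B X +>\<^bsub>Der_rel K A B X\<^esub> D) ` {D \<in> carrier (Der_rel K A B X). D \<in> Inn A X}"
    unfolding iota_def H1_rel_def H1_def
    by (rule a_kernel_induced_map[OF Der_rel_module Inn_rel_submodule Der_module Inn_submodule
          inclusion_hom]) (auto simp: Inn_rel_eq)
  also have "{D \<in> carrier (Der_rel K A B X). D \<in> Inn A X} = Inn_rel A B X"
    by (auto simp: Inn_rel_eq Der_rel_def)
  also have "(\<lambda>D. Inn_rel A B X +>\<^bsub>Der_rel K A B X\<^esub> D) ` Inn_rel A B X = {Inn_rel A B X}"
  proof -
    have "Inn_rel A B X +>\<^bsub>Der_rel K A B X\<^esub> D = Inn_rel A B X" if "D \<in> Inn_rel A B X" for D
      using that N.coset_eq_self_iff N.a_subset by blast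
    then show ?thesis
      using image_constant[OF subgroup.one_closed[OF N.a_subgroup]] by (simp cong: image_cong)
  qed
  also have "Inn_rel A B X = \<zero>\<^bsub>H1_rel K A B X\<^esub>"
    by (simp add: H1_rel_def quotient_module_def)
  finally show ?thesis .
qed

lemma restrict_relative_derivation_in_Inn:
  assumes "D \<in> relative_derivations K A B X"
  shows "restrict D B \<in> Inn (A\<lparr>carrier := B\<rparr>) X"
proof -
  have "restrict D B = \<zero>\<^bsub>Der K (A\<lparr>carrier := B\<rparr>) X\<^esub>"
    using assms by (auto simp: relative_derivations_iff Der_def function_module_def fun_eq_iff)
  then show ?thesis
    using subgroup.one_closed[OF submodule.axioms(1)[OF restr.Inn_submodule]] by simp
qed

text \<open>The element of \<open>X\<close> that makes the restriction of \<open>D\<close> inner also defines an inner derivation of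
  \<open>A\<close>; correcting \<open>D\<close> by it yields the relative representative.\<close>

lemma relative_representative:
  assumes D: "D \<in> derivations K A X" and "restrict D B \<in> Inn (A\<lparr>carrier := B\<rparr>) X"
  shows "\<exists>E \<in> relative_derivations K A B X. D \<in> Inn A X +>\<^bsub>Der K A X\<^esub> E"
proof -
  interpret D: module K "Der K A X" by (rule Der_module)
  obtain x where x: "x \<in> carrier X" "restrict D B = restrict (inner_derivation A X x) B"
    using assms(2) by (auto simp: Inn_def restrict_inner_derivation)
  let ?I = "inner_derivation A X x"
  have carrier: "carrier (Der K A X) = derivations K A X"
    by (simp add: Der_def)
  have I: "?I \<in> derivations K A X"
    by (rule inner_derivation_in_derivations[OF x(1)])
  define E where "E = (\<ominus>\<^bsub>Der K A X\<^esub> ?I) \<oplus>\<^bsub>Der K A X\<^esub> D"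
  have E: "E \<in> derivations K A X"
    using D I D.M.a_closed D.M.a_inv_closed unfolding E_def carrier by blast
  have sum: "D = ?I \<oplus>\<^bsub>Der K A X\<^esub> E"
    using D I D.M.r_neg2 unfolding E_def carrier by simp
  have "E b = \<zero>\<^bsub>X\<^esub>" if b: "b \<in> B" for b
  proof -
    have bA: "b \<in> carrier A"
      using b sub.subset by auto
    have "D b = (?I \<oplus>\<^bsub>Der K A X\<^esub> E) b"
      using sum by (rule arg_cong)
    then have "D b = ?I b \<oplus>\<^bsub>X\<^esub> E b"
      using bA by (simp add: Der_def function_module_def)
    moreover have "D b = ?I b"
      using b x(2) by (metis restrict_apply')
    moreover have "?I b \<in> carrier X" "E b \<in> carrier X"
      using I E bA by (auto simp: derivations_iff)
    ultimately show ?thesis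
      using X.M.add.l_cancel_one' by metis
  qed
  then have "E \<in> relative_derivations K A B X"
    using E by (simp add: relative_derivations_iff)
  moreover have "D \<in> Inn A X +>\<^bsub>Der K A X\<^esub> E"
    using sum x(1) by (auto simp: a_r_coset_def' Inn_def)
  ultimately show ?thesis
    by blast
qed

lemma kernel_kappa: "a_kernel (H1 K A X) (H1 K (A\<lparr>carrier := B\<rparr>) X) (kappa K A B X)
        = iota K A X ` carrier (H1_rel K A B X)"
proof -
  interpret D: module K "Der K A X" by (rule Der_module)
  interpret N: abelian_subgroup "Inn A X" "Der K A X"
    by (rule submodule_imp_abelian_subgroup[OF Der_module Inn_submodule])
  let ?coset = "\<lambda>D. Inn A X +>\<^bsub>Der K A X\<^esub> D"
  have "a_kernel (H1 K A X) (H1 K (A\<lparr>carrier := B\<rparr>) X) (kappa K A B X)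
      = ?coset ` {D \<in> derivations K A X. restrict D B \<in> Inn (A\<lparr>carrier := B\<rparr>) X}"
    unfolding kappa_def H1_def
    by (subst a_kernel_induced_map[OF Der_module Inn_submodule restr.Der_module
          restr.Inn_submodule restrict_hom restrict_Inn]) (simp add: Der_def)
  also have "\<dots> = ?coset ` relative_derivations K A B X"
  proof (intro equalityI image_subsetI)
    fix D assume "D \<in> {D \<in> derivations K A X. restrict D B \<in> Inn (A\<lparr>carrier := B\<rparr>) X}"
    then obtain E where E: "E \<in> relative_derivations K A B X" "D \<in> ?coset E"
      using relative_representative by blast
    then have "?coset E = ?coset D"
      by (intro D.M.a_repr_independence N.a_subgroup)
        (auto simp: relative_derivations_iff Der_def)
    then show "?coset D \<in> ?coset ` relative_derivations K A B X"
      using E(1) by (metis imageI)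
  next
    fix E assume "E \<in> relative_derivations K A B X"
    then show "?coset E \<in> ?coset ` {D \<in> derivations K A X.
        restrict D B \<in> Inn (A\<lparr>carrier := B\<rparr>) X}"
      using restrict_relative_derivation_in_Inn relative_derivations_iff by blast
  qed
  also have "\<dots> = iota K A X ` carrier (H1_rel K A B X)"
  proof -
    have "carrier (Der_rel K A B X) = relative_derivations K A B X"
      by (simp add: Der_rel_def)
    then show ?thesis
      by (simp add: H1_rel_def carrier_quotient_module image_image iota_coset cong: image_cong)
  qed
  finally show ?thesis .
qed

end

theorem proposition3p3:
  fixes K :: "('k, 'r) ring_scheme"
    and A :: "('k, 'a, 'm) module_scheme"
    and B :: "'a set"
    and X :: "('k, 'a, 'x, 'n) bimodule_scheme"
  assumes "field K"
    and "assoc_algebra K A"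
    and "unital_subalgebra B K A"
    and "bimodule K A X"
  shows "module K (H1_rel K A B X) \<and> module K (H1 K A X) \<and> module K (H1 K (A\<lparr>carrier := B\<rparr>) X)
    \<and> iota K A X \<in> module_hom K (H1_rel K A B X) (H1 K A X)
    \<and> kappa K A B X \<in> module_hom K (H1 K A X) (H1 K (A\<lparr>carrier := B\<rparr>) X)
    \<and> a_kernel (H1_rel K A B X) (H1 K A X) (iota K A X) = {\<zero>\<^bsub>H1_rel K A B X\<^esub>}
    \<and> a_kernel (H1 K A X) (H1 K (A\<lparr>carrier := B\<rparr>) X) (kappa K A B X)
        = iota K A X ` carrier (H1_rel K A B X)"
proof -
  interpret bimodule_over_subalgebra K A X B
    using assms by (intro bimodule_over_subalgebra.intro)
  show ?thesis
    by (intro conjI H1_rel_module H1_module restr.H1_module iota_hom kappa_hom kernel_iota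
        kernel_kappa)
qed

end
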